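(* Let $G=(L\cup R,\mathcal{E})$ be a bipartite graph with left degree $D$ that is a $(K_{max},(1-\epsilon)D)$ expander, where $K_{max}\ge1$ is an integer and $\epsilon>0$. Then $G$ admits $((1-4\epsilon)D,\ 2\lceil\log_2 K_{max}\rceil)$ online matching up to size $K_{max}$. Moreover, if $G$ is explicit, such an assignment function $f(S,x)$ can be computed in time $\mathrm{poly}(K_{max},D,\log|L|)$.
   Context: Bipartite graphs may have multiple edges ($\mathcal{E}$ a multiset); left degree $D$ means every left node has exactly $D$ incident edges; $\mathcal{N}(x)$ is the multiset of neighbors of $x$; $N(S)$ is the set of right nodes adjacent to some node of $S$. $G$ is a $(K,\gamma)$ expander if $|N(S)|\ge\gamma|S|$ for every $S\subseteq L$ with $|S|\le K$. Online matching: $G$ admits $(\ell,r)$ online matching up to size $K$ if there is a function $f$ assigning to every list $S$ of elements of $L$ of length at most $K$ and every $x\in L$ a multiset $f(S,x)$ over $R$ such that: (1) $f(S,x)\subseteq\mathcal{N}(x)$ (as multisets); (2) $f(S,x)=\emptyset$ if $x$ does not occur in $S$; (3) if $x$ occurs in $S$ then $f(S',x)=f(S,x)$ for every list $S'$ of length at most $K$ having $S$ as a prefix; (4) if $x$ occurs in $S$ then $|f(S,x)|\ge\ell$ (counting multiplicity); (5) for every $p\in R$ at most $r$ distinct $x$ occurring in $S$ have $p\in f(S,x)$. $G$ is explicit if it belongs to a family indexed by $\log|L|$ with a $\mathrm{poly}(\log|L|)$-time algorithm that on input $x\in L$, $i\in\{1,\dots,D\}$ outputs the $i$-th neighbor of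 $x$.
   Formalization: For K_max = 1 the additional assumption (1-4ε)D ≤ 0 is made: there the load bound 2⌈log₂ K_max⌉ is 0, so no right node may be used and the claim fails (e.g. one left node with 10 distinct neighbors, D = 10, ε = 0.1). *)

theory Defs
  imports Complex_Main "HOL-Library.Multiset" "HOL-Library.Sublist"
    "HOL-Computational_Algebra.Polynomial"
begin

section \<open>Bipartite multigraphs, expanders, online matching\<close>

record ('a, 'b) bigraph =
  left_nodes :: "'a set"
  right_nodes :: "'b set"
  edges :: "('a \<times> 'b) multiset"

definition bipartite_graph :: "('a, 'b) bigraph \<Rightarrow> bool" where
  "bipartite_graph G \<longleftrightarrow> finite (left_nodes G) \<and> finite (right_nodes G) \<and>
     set_mset (edges G) \<subseteq> left_nodes G \<times> right_nodes G"

definition neighbors :: "('a, 'b) bigraph \<Rightarrow> 'a \<Rightarrow> 'b multiset" where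
  "neighbors G x = image_mset snd (filter_mset (\<lambda>e. fst e = x) (edges G))"

definition left_degree :: "('a, 'b) bigraph \<Rightarrow> nat \<Rightarrow> bool" where
  "left_degree G D \<longleftrightarrow>
     (\<forall>x\<in>left_nodes G. size (filter_mset (\<lambda>e. fst e = x) (edges G)) = D)"

definition neighbor_set :: "('a, 'b) bigraph \<Rightarrow> 'a set \<Rightarrow> 'b set" where
  "neighbor_set G S = {p \<in> right_nodes G. \<exists>x\<in>S. (x, p) \<in># edges G}"

definition expander :: "('a, 'b) bigraph \<Rightarrow> nat \<Rightarrow> real \<Rightarrow> bool" where
  "expander G K \<gamma> \<longleftrightarrow>
     (\<forall>S. S \<subseteq> left_nodes G \<and> card S \<le> K \<longrightarrow> real (card (neighbor_set G S)) \<ge> \<gamma> * real (card S))"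

text \<open>
  An assignment is a total HOL function; only its values on lists over the left nodes of length at
  most \<open>K\<close> and on left nodes matter. The size bound \<open>l\<close> is real because it need not be an integer.
\<close>

definition online_matching ::
  "('a, 'b) bigraph \<Rightarrow> real \<Rightarrow> nat \<Rightarrow> nat \<Rightarrow> ('a list \<Rightarrow> 'a \<Rightarrow> 'b multiset) \<Rightarrow> bool" where
  "online_matching G l r K f \<longleftrightarrow>
     (\<forall>S\<in>lists (left_nodes G). length S \<le> K \<longrightarrow>
        (\<forall>x\<in>left_nodes G.
           f S x \<subseteq># neighbors G x \<and>
           (x \<notin> set S \<longrightarrow> f S x = {#}) \<and>
           (x \<in> set S \<longrightarrow>
              (\<forall>S'\<in>lists (left_nodes G). length S' \<le> K \<and> prefix S S' \<longrightarrow> f S' x = f S x)) \<and>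
           (x \<in> set S \<longrightarrow> real (size (f S x)) \<ge> l)) \<and>
        (\<forall>p\<in>right_nodes G. card {x \<in> set S. p \<in># f S x} \<le> r))"

definition admits_online_matching :: "('a, 'b) bigraph \<Rightarrow> real \<Rightarrow> nat \<Rightarrow> nat \<Rightarrow> bool" where
  "admits_online_matching G l r K \<longleftrightarrow> (\<exists>f. online_matching G l r K f)"

text \<open>
  Load \<open>r = 0\<close> leaves no room for any assignment. In particular \<open>2 * \<lceil>log 2 K\<rceil> = 0\<close> for \<open>K = 1\<close>, so
  a graph with a left node admits \<open>(l, 2 * \<lceil>log 2 K\<rceil>)\<close> online matching up to size 1 only if \<open>l \<le> 0\<close>.
\<close>

lemma online_matching_load_0:
  assumes "bipartite_graph G" "online_matching G l 0 K f" "1 \<le> K" "x \<in> left_nodes G"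
  shows "l \<le> 0"
proof -
  have S: "[x] \<in> lists (left_nodes G)" "length [x] \<le> K" using assms by auto
  note om = assms(2)[unfolded online_matching_def, rule_format, OF S]
  have sub: "f [x] x \<subseteq># neighbors G x" and sz: "l \<le> real (size (f [x] x))"
    using om assms(4) by auto
  have "p \<notin># f [x] x" for p
  proof
    assume p: "p \<in># f [x] x"
    then have "p \<in># neighbors G x" using sub by (rule mset_subset_eqD[rotated])
    then have "p \<in> right_nodes G"
      using assms(1) by (auto simp: neighbors_def bipartite_graph_def)
    then have "card {y \<in> set [x]. p \<in># f [x] y} \<le> 0" using om by blast
    moreover have "{y \<in> set [x]. p \<in># f [x] y} = {x}" using p by auto
    ultimately have "card {x} \<le> 0" by (simp only:)
    then show False by simp
  qed
  then have "f [x] x = {#}" by (metis multiset_nonemptyE)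
  then show ?thesis using sz by simp
qed

section \<open>Model of computation\<close>

text \<open>
  Running time is measured in a first-order functional language over binary trees in the style of
  Neil Jones (Computability and Complexity from a Programming Perspective): the only data are
  binary trees, every function has one argument, and evaluating a program costs one unit per
  elementary step (building a node, taking a subtree, testing for a leaf, calling a function).
  Since trees can be stored with shared subtrees and there is no primitive comparing two trees,
  each step is constant time on a pointer machine; computing flat (list-like) outputs in
  polynomial time means the same here as on Turing machines.
\<close>

datatype tree = Leaf | Node tree tree

fun left_part :: "tree \<Rightarrow> tree" where
  "left_part Leaf = Leaf"
| "left_part (Node a b) = a"

fun right_part :: "tree \<Rightarrow> tree" where
  "right_part Leaf = Leaf"
| "right_part (Node a b) = b"

datatype expr =
    Arg
  | LeafE
  | NodeE expr expr
  | LeftE expr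
  | RightE expr
  | IfE expr expr expr
  | CallE nat expr

text \<open>
  \<open>eval F v e w t\<close>: with function bodies \<open>F\<close> (\<open>CallE k\<close> calls \<open>F ! k\<close>, which may be recursive)
  and argument value \<open>v\<close>, the expression \<open>e\<close> evaluates to \<open>w\<close> in exactly \<open>t\<close> steps.
  A diverging evaluation, or one calling an undefined function, has no derivation.
\<close>

inductive eval :: "expr list \<Rightarrow> tree \<Rightarrow> expr \<Rightarrow> tree \<Rightarrow> nat \<Rightarrow> bool" for F where
  eval_Arg: "eval F v Arg v 1"
| eval_Leaf: "eval F v LeafE Leaf 1"
| eval_Node: "eval F v a u s \<Longrightarrow> eval F v b w t \<Longrightarrow> eval F v (NodeE a b) (Node u w) (Suc (s + t))"
| eval_Left: "eval F v a u s \<Longrightarrow> eval F v (LeftE a) (left_part u) (Suc s)"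
| eval_Right: "eval F v a u s \<Longrightarrow> eval F v (RightE a) (right_part u) (Suc s)"
| eval_If_Node: "eval F v c u s \<Longrightarrow> u \<noteq> Leaf \<Longrightarrow> eval F v a w t \<Longrightarrow>
    eval F v (IfE c a b) w (Suc (s + t))"
| eval_If_Leaf: "eval F v c Leaf s \<Longrightarrow> eval F v b w t \<Longrightarrow> eval F v (IfE c a b) w (Suc (s + t))"
| eval_Call: "eval F v a u s \<Longrightarrow> k < length F \<Longrightarrow> eval F u (F ! k) w t \<Longrightarrow>
    eval F v (CallE k a) w (Suc (s + t))"

lemma eval_deterministic:
  assumes "eval F v e w t" "eval F v e w' t'"
  shows "w = w' \<and> t = t'"
  using assms
proof (induction arbitrary: w' t' rule: eval.induct)
  case eval_Arg then show ?case by (auto elim: eval.cases)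
next
  case eval_Leaf then show ?case by (auto elim: eval.cases)
next
  case eval_Node from eval_Node.prems show ?case by cases (use eval_Node.IH in blast)
next
  case eval_Left from eval_Left.prems show ?case by cases (use eval_Left.IH in blast)
next
  case eval_Right from eval_Right.prems show ?case by cases (use eval_Right.IH in blast)
next
  case eval_If_Node from eval_If_Node.prems show ?case
    by cases (use eval_If_Node.IH eval_If_Node.hyps in blast)+
next
  case eval_If_Leaf from eval_If_Leaf.prems show ?case
    by cases (use eval_If_Leaf.IH in blast)+
next
  case eval_Call from eval_Call.prems show ?case by cases (use eval_Call.IH in blast)
qed

text \<open>A program consists of its function bodies and a main expression applied to the input.\<close>

type_synonym program = "expr list \<times> expr"

definition computes_within :: "program \<Rightarrow> tree \<Rightarrow> tree \<Rightarrow> nat \<Rightarrow> bool" where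
  "computes_within P inp out T \<longleftrightarrow> (\<exists>t\<le>T. eval (fst P) inp (snd P) out t)"

fun enc_list :: "('a \<Rightarrow> tree) \<Rightarrow> 'a list \<Rightarrow> tree" where
  "enc_list enc [] = Leaf"
| "enc_list enc (a # as) = Node (enc a) (enc_list enc as)"

definition enc_bit :: "bool \<Rightarrow> tree" where
  "enc_bit b = (if b then Node Leaf Leaf else Leaf)"

definition enc_string :: "bool list \<Rightarrow> tree" where
  "enc_string = enc_list enc_bit"

text \<open>Binary representation, least significant bit first.\<close>

fun nat_bits :: "nat \<Rightarrow> bool list" where
  "nat_bits m = (if m = 0 then [] else odd m # nat_bits (m div 2))"

declare nat_bits.simps [simp del]

definition enc_nat :: "nat \<Rightarrow> tree" where
  "enc_nat m = enc_string (nat_bits m)"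

section \<open>Explicit graphs\<close>

text \<open>
  Explicitness is a property of a family \<open>G\<close> indexed by \<open>n = log |L|\<close>, where the left nodes of
  \<open>G n\<close> are the strings of \<open>n\<close> bits, right nodes are bit strings, and \<open>D n\<close> is the left degree.
  One program, in time polynomial in \<open>n\<close>, maps \<open>(x, i)\<close> to the \<open>i\<close>-th neighbor of \<open>x\<close>, for some
  enumeration \<open>nb 1, \<dots>, nb (D n)\<close> of the multiset of neighbors of \<open>x\<close>.
\<close>

definition explicit_family ::
  "(nat \<Rightarrow> (bool list, bool list) bigraph) \<Rightarrow> (nat \<Rightarrow> nat) \<Rightarrow> bool" where
  "explicit_family G D \<longleftrightarrow>
     (\<forall>n. bipartite_graph (G n) \<and> left_nodes (G n) = {x. length x = n} \<and> left_degree (G n) (D n)) \<and>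
     (\<exists>P (p :: nat poly). \<forall>n. \<forall>x\<in>left_nodes (G n). \<exists>nb.
        neighbors (G n) x = mset (map nb [1..<Suc (D n)]) \<and>
        (\<forall>i\<in>{1..D n}.
           computes_within P (Node (enc_string x) (enc_nat i)) (enc_string (nb i)) (poly p n)))"

text \<open>
  Input of a program computing assignments: the parameters \<open>K\<close>, \<open>D\<close> and the demanded number \<open>l\<close>
  of right nodes, then the list \<open>S\<close> and the node \<open>x\<close>.
\<close>

definition enc_matching_input :: "nat \<Rightarrow> nat \<Rightarrow> nat \<Rightarrow> bool list list \<Rightarrow> bool list \<Rightarrow> tree" where
  "enc_matching_input K D l S x =
     Node (enc_nat K) (Node (enc_nat D) (Node (enc_nat l)
       (Node (enc_list enc_string S) (enc_string x))))"

text \<open>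
  Assignments with values in multisets of bit strings are output as lists, in any order. The time
  bound is a polynomial in \<open>K + D + n\<close>, which for natural numbers is the same as a polynomial in
  \<open>K\<close>, \<open>D\<close> and \<open>n\<close>.
\<close>

definition computes_assignment ::
  "program \<Rightarrow> nat poly \<Rightarrow> nat \<Rightarrow> nat \<Rightarrow> nat \<Rightarrow> nat \<Rightarrow>
     (bool list list \<Rightarrow> bool list \<Rightarrow> bool list multiset) \<Rightarrow> bool" where
  "computes_assignment P p n K D l f \<longleftrightarrow>
     (\<forall>S x. set S \<subseteq> {y. length y = n} \<and> length S \<le> K \<and> length x = n \<longrightarrow>
        (\<exists>zs. mset zs = f S x \<and>
           computes_within P (enc_matching_input K D l S x) (enc_list enc_string zs)
             (poly p (K + D + n))))"

end

theory Submission
  imports Defs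
begin

text \<open>
  First fit over layers. A layer is a set of taken right nodes; a new left node goes to the first
  layer in which at least \<open>l = \<lceil>(1 - 4 * \<epsilon>) * D\<rceil>\<close> of its neighbors are not taken, and is assigned
  all of these, so every layer adds at most one to the load of a right node. Suppose that \<open>s\<close> nodes
  reach a layer and \<open>f\<close> of them are rejected. The neighbors of accepted nodes are all taken, so a
  rejected node has fewer than \<open>(1 - 4 * \<epsilon>) * D\<close> neighbors outside the neighborhood of the others,
  and expansion gives \<open>(1 - \<epsilon>) * D * s \<le> D * (s - f) + (1 - 4 * \<epsilon>) * D * f\<close>, that is,
  \<open>4 * f \<le> s\<close>. Hence \<open>m\<close> layers suffice as soon as \<open>K < 4 ^ m\<close>, and \<open>m = 2 * \<lceil>log 2 K\<rceil>\<close>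
  is enough for \<open>K \<ge> 2\<close>. The state of the algorithm is a list of lists of right nodes, so recomputing it from
  \<open>S\<close> takes polynomial time.
\<close>

section \<open>First fit over layers\<close>

text \<open>The empty case stands for opening a new layer: nothing is taken there, so all of
  \<open>B\<close> is assigned. \<open>extend_layers\<close> makes the same choice but returns the
  updated state.\<close>

fun choose_layer :: "nat \<Rightarrow> 'b list \<Rightarrow> 'b list list \<Rightarrow> 'b list" where
  "choose_layer l B [] = B"
| "choose_layer l B (T # Ts) =
     (let Z = filter (\<lambda>p. p \<notin> set T) B in if l \<le> length Z then Z else choose_layer l B Ts)"

fun extend_layers :: "nat \<Rightarrow> 'b list \<Rightarrow> 'b list list \<Rightarrow> 'b list list" where
  "extend_layers l B [] = [B]"
| "extend_layers l B (T # Ts) =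
     (let Z = filter (\<lambda>p. p \<notin> set T) B
      in if l \<le> length Z then (Z @ T) # Ts else T # extend_layers l B Ts)"

text \<open>Stopping at the first occurrence of \<open>x\<close> makes the value independent of
  whatever follows it; skipping the nodes in \<open>seen\<close> lets every left node claim
  neighbors only once.\<close>

fun first_fit ::
  "('a \<Rightarrow> 'b list) \<Rightarrow> nat \<Rightarrow> 'a \<Rightarrow> 'a list \<Rightarrow> 'b list list \<Rightarrow> 'a list \<Rightarrow> 'b list" where
  "first_fit nb l x seen Ts [] = []"
| "first_fit nb l x seen Ts (y # ys) =
     (if y \<in> set seen then first_fit nb l x seen Ts ys
      else if x = y then choose_layer l (nb y) Ts
      else first_fit nb l x (y # seen) (extend_layers l (nb y) Ts) ys)"

section \<open>Containment, size and stability of the assignment\<close>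

lemma choose_layer_subset: "mset (choose_layer l B Ts) \<subseteq># mset B"
  by (induction Ts) (auto simp: Let_def mset_filter)

lemma length_choose_layer: "l \<le> length B \<Longrightarrow> l \<le> length (choose_layer l B Ts)"
  by (induction Ts) (auto simp: Let_def)

lemma first_fit_subset: "mset (first_fit nb l x seen Ts S) \<subseteq># mset (nb x)"
  by (induction nb l x seen Ts S rule: first_fit.induct) (auto simp: choose_layer_subset)

lemma first_fit_notin: "x \<notin> set S \<Longrightarrow> first_fit nb l x seen Ts S = []"
  by (induction nb l x seen Ts S rule: first_fit.induct) auto

lemma length_first_fit:
  "x \<in> set S \<Longrightarrow> x \<notin> set seen \<Longrightarrow> l \<le> length (nb x) \<Longrightarrow> l \<le> length (first_fit nb l x seen Ts S)"
  by (induction nb l x seen Ts S rule: first_fit.induct) (auto simp: length_choose_layer)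

text \<open>The recursion ends at the first occurrence of \<open>x\<close>, which lies in
  \<open>S\<close>. This gives the online condition.\<close>

lemma first_fit_append:
  "x \<in> set S \<Longrightarrow> x \<notin> set seen \<Longrightarrow>
     first_fit nb l x seen Ts (S @ S') = first_fit nb l x seen Ts S"
  by (induction nb l x seen Ts S rule: first_fit.induct) auto

text \<open>The nodes chosen are disjoint from the layer they join, so the number of layers
  containing \<open>p\<close> records how often \<open>p\<close> has been assigned. Bounding the
  load thus reduces to bounding the number of layers.\<close>

lemma layers_containing_extend_layers:
  "length (filter (\<lambda>T. p \<in> set T) (extend_layers l B Ts)) =
     length (filter (\<lambda>T. p \<in> set T) Ts) + (if p \<in> set (choose_layer l B Ts) then 1 else 0)"
  by (induction Ts) (auto simp: Let_def)

section \<open>The layer invariant and the load bound\<close>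

text \<open>
  \<open>S\<close> are the left nodes that reached the first layer of \<open>Ts\<close> and \<open>A\<close> those accepted there; a
  rejected node contributes fewer than \<open>l\<close> new neighbors to the first layer.
\<close>

fun layered :: "('a \<Rightarrow> 'b list) \<Rightarrow> nat \<Rightarrow> nat \<Rightarrow> 'a set \<Rightarrow> 'b list list \<Rightarrow> bool" where
  "layered nb D l S [] \<longleftrightarrow> S = {}"
| "layered nb D l S (T # Ts) \<longleftrightarrow> S \<noteq> {} \<and>
     (\<exists>A\<subseteq>S. set T = (\<Union>x\<in>A. set (nb x)) \<and>
        card (\<Union>x\<in>S. set (nb x)) \<le> D * card A + (l - 1) * card (S - A) \<and>
        layered nb D l (S - A) Ts)"

text \<open>If the first layer accepts \<open>x\<close>, then \<open>x\<close> joins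
  \<open>A\<close> at the cost of at most \<open>D\<close> new neighbors, and the layer now contains
  all neighbors of \<open>x\<close>. If it rejects \<open>x\<close>, then fewer than
  \<open>l\<close> neighbors of \<open>x\<close> lie outside the layer, which is part of the
  neighborhood of \<open>S\<close>, and \<open>x\<close> moves on to the later layers.\<close>

lemma layered_extend_layers:
  assumes "layered nb D l S Ts" "finite S" "x \<notin> S" "length (nb x) = D"
  shows "layered nb D l (insert x S) (extend_layers l (nb x) Ts)"
  using assms
proof (induction Ts arbitrary: S)
  case Nil
  \<comment> \<open>Here \<open>S\<close> is empty, so the new layer has \<open>x\<close> as its
    only accepted node; parallel edges can only make the neighborhood smaller.\<close>
  have "card (set (nb x)) \<le> D" using Nil.prems(4) card_length by blast
  then show ?case using Nil by (auto intro!: exI[of _ "{x}"])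
next
  case (Cons T Ts)
  let ?N = "\<lambda>S. \<Union>x\<in>S. set (nb x)"
  obtain A where A: "A \<subseteq> S" "set T = ?N A"
      "card (?N S) \<le> D * card A + (l - 1) * card (S - A)" "layered nb D l (S - A) Ts"
    using Cons.prems(1) by auto
  define Z where "Z = filter (\<lambda>p. p \<notin> set T) (nb x)"
  have x: "x \<notin> A" and fin: "finite A" using A(1) Cons.prems finite_subset by auto
  show ?case
  proof (cases "l \<le> length Z")
    case True
    have "card (?N (insert x S)) \<le> card (set (nb x)) + card (?N S)"
      by (simp add: card_Un_le)
    also have "card (set (nb x)) \<le> D" using Cons.prems(4) card_length by blast
    finally have "card (?N (insert x S)) \<le> D * card (insert x A) + (l - 1) * card (S - A)"
      using A(3) x fin by simp
    moreover have "insert x S - insert x A = S - A" using Cons.prems(3) by auto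
    moreover have "set (Z @ T) = ?N (insert x A)" using A(2) by (auto simp: Z_def)
    ultimately have "layered nb D l (insert x S) ((Z @ T) # Ts)"
      unfolding layered.simps using A(1,4) by (intro conjI exI[of _ "insert x A"]) auto
    then show ?thesis using True by (simp add: Z_def Let_def)
  next
    case False
    have "card (?N (insert x S)) \<le> card (set Z \<union> ?N S)"
      using A(1,2) Cons.prems(2) by (intro card_mono) (auto simp: Z_def)
    also have "\<dots> \<le> card (set Z) + card (?N S)" by (rule card_Un_le)
    also have "card (set Z) \<le> l - 1" using False card_length[of Z] by linarith
    finally have "card (?N (insert x S)) \<le> D * card A + (l - 1) * Suc (card (S - A))"
      using A(3) by simp
    moreover have eq: "insert x S - A = insert x (S - A)" using x by auto
    moreover have "card (insert x (S - A)) = Suc (card (S - A))"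
      using Cons.prems(2,3) by simp
    moreover have "layered nb D l (insert x (S - A)) (extend_layers l (nb x) Ts)"
      using Cons.IH[OF A(4)] Cons.prems by auto
    ultimately have "layered nb D l (insert x S) (T # extend_layers l (nb x) Ts)"
      unfolding layered.simps using A(1,2) by (intro conjI exI[of _ A]) auto
    then show ?thesis using False by (simp add: Z_def Let_def)
  qed
qed

text \<open>Expansion forces at most a quarter of the nodes that reach a layer to be rejected there.\<close>

lemma length_layered:
  fixes \<epsilon> :: real
  assumes "layered nb D l S Ts" "finite S" "card S < 4 ^ m" "0 < \<epsilon>" "0 < D"
    and l: "real (l - 1) \<le> (1 - 4 * \<epsilon>) * real D"
    and expand: "\<And>S'. S' \<subseteq> S \<Longrightarrow> (1 - \<epsilon>) * real D * real (card S') \<le> real (card (\<Union>x\<in>S'. set (nb x)))"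
  shows "length Ts \<le> m"
  using assms(1-3) expand
proof (induction Ts arbitrary: S m)
  case Nil
  then show ?case by simp
next
  case (Cons T Ts)
  obtain A where A: "A \<subseteq> S"
      "card (\<Union>x\<in>S. set (nb x)) \<le> D * card A + (l - 1) * card (S - A)" "layered nb D l (S - A) Ts"
    using Cons.prems(1) by auto
  \<comment> \<open>\<open>S\<close> is nonempty, so \<open>card S < 4 ^ m\<close> rules out
    \<open>m = 0\<close>.\<close>
  obtain m' where m: "m = Suc m'" using Cons.prems(1-3) by (cases m) auto
  have card: "card S = card A + card (S - A)"
    using A(1) Cons.prems(2) by (metis card_Diff_subset card_mono finite_subset le_add_diff_inverse)
  have "(1 - \<epsilon>) * real D * real (card S) \<le> real (D * card A + (l - 1) * card (S - A))"
    using Cons.prems(4)[of S] A(2) by (meson of_nat_le_iff order.trans subset_refl)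
  also have "\<dots> \<le> real D * real (card A) + (1 - 4 * \<epsilon>) * real D * real (card (S - A))"
    using mult_right_mono[OF l, of "real (card (S - A))"] by simp
  \<comment> \<open>With \<open>card S\<close> split into accepted and rejected nodes, all terms
    without \<open>\<epsilon>\<close> cancel.\<close>
  finally have "(\<epsilon> * real D) * (4 * real (card (S - A))) \<le> (\<epsilon> * real D) * real (card S)"
    by (simp add: card algebra_simps)
  then have "4 * real (card (S - A)) \<le> real (card S)"
    using assms(4,5) by (simp add: mult_le_cancel_left_pos)
  then have "card (S - A) < 4 ^ m'" using Cons.prems(3) m by simp
  then have "length Ts \<le> m'"
    using Cons.IH[OF A(3)] Cons.prems(2,4) by (meson Diff_subset finite_Diff order.trans)
  then show ?case by (simp add: m)
qed

text \<open>The load of \<open>p\<close> is split into the part already spent, counted by the layers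
  containing \<open>p\<close>, and the part still to come from the nodes of \<open>S\<close>.
  Processing a new \<open>y\<close> moves its share from the latter to the former; at the end only
  layers remain, and there are at most \<open>m\<close> of them.\<close>

lemma load_first_fit:
  assumes "layered nb D l (set seen) Ts" "\<And>x. x \<in> set S \<Longrightarrow> length (nb x) = D"
    and "\<And>A Ts. A \<subseteq> set seen \<union> set S \<Longrightarrow> layered nb D l A Ts \<Longrightarrow> length Ts \<le> m"
  shows "card {x \<in> set S - set seen. p \<in> set (first_fit nb l x seen Ts S)} +
           length (filter (\<lambda>T. p \<in> set T) Ts) \<le> m"
  using assms
proof (induction S arbitrary: seen Ts)
  case Nil
  have "length (filter (\<lambda>T. p \<in> set T) Ts) \<le> length Ts" by simp
  also have "\<dots> \<le> m" using Nil(1) Nil(3)[of "set seen"] by simp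
  finally show ?case by simp
next
  case (Cons y S)
  show ?case
  proof (cases "y \<in> set seen")
    case True
    then have "{x \<in> set (y # S) - set seen. p \<in> set (first_fit nb l x seen Ts (y # S))} =
        {x \<in> set S - set seen. p \<in> set (first_fit nb l x seen Ts S)}" by auto
    then show ?thesis using Cons.IH[of seen Ts] Cons.prems True by (simp add: insert_absorb)
  next
    case False
    let ?Ts = "extend_layers l (nb y) Ts"
    let ?X = "{x \<in> set S - set (y # seen). p \<in> set (first_fit nb l x (y # seen) ?Ts S)}"
    have lay: "layered nb D l (set (y # seen)) ?Ts"
      using layered_extend_layers[of nb D l "set seen" Ts y] Cons.prems(1,2) False by simp
    have IH: "card ?X + length (filter (\<lambda>T. p \<in> set T) ?Ts) \<le> m"
      by (rule Cons.IH[OF lay]) (use Cons.prems in auto)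
    have "{x \<in> set (y # S) - set seen. p \<in> set (first_fit nb l x seen Ts (y # S))} \<subseteq>
        ?X \<union> (if p \<in> set (choose_layer l (nb y) Ts) then {y} else {})" (is "?Y \<subseteq> _")
      using False by auto
    then have "card ?Y \<le> card (?X \<union> (if p \<in> set (choose_layer l (nb y) Ts) then {y} else {}))"
      by (intro card_mono) auto
    also have "\<dots> \<le> card ?X + (if p \<in> set (choose_layer l (nb y) Ts) then 1 else 0)"
      by (rule order.trans[OF card_Un_le]) simp
    finally show ?thesis using IH by (simp add: layers_containing_extend_layers)
  qed
qed

text \<open>For \<open>c = \<lceil>log 2 K\<rceil>\<close> the right-hand side is
  \<open>2 ^ (4 * c)\<close>, and \<open>log 2 K \<le> c < 4 * c\<close> because
  \<open>c > 0\<close>. For \<open>K = 1\<close> both sides would be 1.\<close>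

lemma less_4_power_log:
  assumes "2 \<le> K"
  shows "K < 4 ^ nat (2 * \<lceil>log 2 (real K)\<rceil>)"
proof -
  have "0 < log 2 (real K)" using assms by simp
  then have "log 2 (real K) < real (2 * nat (2 * \<lceil>log 2 (real K)\<rceil>))" by linarith
  then have "real K < 2 powr real (2 * nat (2 * \<lceil>log 2 (real K)\<rceil>))"
    using assms by (subst (asm) log_less_iff) auto
  also have "\<dots> = real (4 ^ nat (2 * \<lceil>log 2 (real K)\<rceil>))"
    by (subst powr_realpow) (simp_all add: power_mult)
  finally show ?thesis by (simp only: of_nat_less_iff)
qed

text \<open>For \<open>K = 1\<close> the load bound is 0, which the empty assignment (\<open>l = 0\<close>) respects.\<close>

lemma online_matching_first_fit:
  assumes G: "bipartite_graph G" "left_degree G D" and "1 \<le> K" "0 < \<epsilon>"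
    and ex: "expander G K ((1 - \<epsilon>) * real D)"
    and K1: "K = 1 \<longrightarrow> (1 - 4 * \<epsilon>) * real D \<le> 0"
    and nb: "\<And>x. x \<in> left_nodes G \<Longrightarrow> mset (nb x) = neighbors G x"
    and l: "l = nat \<lceil>(1 - 4 * \<epsilon>) * real D\<rceil>"
  shows "online_matching G ((1 - 4 * \<epsilon>) * real D) (nat (2 * \<lceil>log 2 (real K)\<rceil>)) K
    (\<lambda>S x. if l = 0 then {#} else mset (first_fit nb l x [] [] S))"
proof (cases "l = 0")
  case True
  then have "(1 - 4 * \<epsilon>) * real D \<le> 0" unfolding l by linarith
  then show ?thesis using True by (simp add: online_matching_def)
next
  case False
  then have "(1 - 4 * \<epsilon>) * real D > 0" unfolding l by linarith
  then have D: "0 < D" and K: "2 \<le> K" using K1 \<open>1 \<le> K\<close> by (auto intro: Nat.gr0I)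
  have lD: "l \<le> D"
  proof -
    have "(1 - 4 * \<epsilon>) * real D \<le> real D"
      using mult_right_mono[of "1 - 4 * \<epsilon>" 1 "real D"] \<open>0 < \<epsilon>\<close> by simp
    then show ?thesis unfolding l by linarith
  qed
  \<comment> \<open>Rounding costs nothing: \<open>l\<close> nodes meet the demand, while a rejected
    node brings at most \<open>l - 1\<close> new neighbors, still within the real bound. The first
    inequality relies on \<open>l \<noteq> 0\<close>.\<close>
  have l1: "real (l - 1) \<le> (1 - 4 * \<epsilon>) * real D" and lr: "(1 - 4 * \<epsilon>) * real D \<le> real l"
    using False unfolding l by linarith+
  have len: "length (nb x) = D" if "x \<in> left_nodes G" for x
    using G(2) nb[OF that] that
    by (metis left_degree_def neighbors_def size_image_mset size_mset)
  have N: "neighbor_set G S = (\<Union>x\<in>S. set (nb x))" if "S \<subseteq> left_nodes G" for S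
  proof -
    have "p \<in> set (nb x) \<longleftrightarrow> p \<in> right_nodes G \<and> (x, p) \<in># edges G" if "x \<in> left_nodes G" for x p
      using G(1) nb[OF that] that
      by (auto simp: bipartite_graph_def neighbors_def set_mset_mset[symmetric] image_iff
          simp del: set_mset_mset)
    then show ?thesis using that by (auto simp: neighbor_set_def)
  qed
  \<comment> \<open>A layered state over nodes of the list involves at most \<open>K\<close> of
    them, so expansion applies to every subset of these.\<close>
  have layers: "length Ts \<le> nat (2 * \<lceil>log 2 (real K)\<rceil>)"
    if "S \<in> lists (left_nodes G)" "length S \<le> K" "A \<subseteq> set S" "layered nb D l A Ts" for S A Ts
  proof (rule length_layered[OF that(4) _ _ \<open>0 < \<epsilon>\<close> D l1])
    have fin: "finite A" using that(3) finite_subset by blast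
    show "finite A" by fact
    have card: "card A \<le> K"
      using that(2,3) by (meson List.finite_set card_length card_mono order.trans)
    then show "card A < 4 ^ nat (2 * \<lceil>log 2 (real K)\<rceil>)"
      using less_4_power_log[OF K] by linarith
    fix S' assume S': "S' \<subseteq> A"
    then have L: "S' \<subseteq> left_nodes G" using that(1,3) by auto
    have "card S' \<le> K" using S' fin card card_mono order.trans by blast
    then show "(1 - \<epsilon>) * real D * real (card S') \<le> real (card (\<Union>x\<in>S'. set (nb x)))"
      using ex L N[OF L] by (auto simp: expander_def)
  qed
  show ?thesis
    unfolding online_matching_def if_not_P[OF False]
  proof (intro ballI impI conjI)
    fix S x assume S: "S \<in> lists (left_nodes G)" "length S \<le> K" and x: "x \<in> left_nodes G"
    show "mset (first_fit nb l x [] [] S) \<subseteq># neighbors G x"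
      using first_fit_subset[of nb l x] nb[OF x] by simp
    show "x \<notin> set S \<Longrightarrow> mset (first_fit nb l x [] [] S) = {#}"
      by (simp add: first_fit_notin)
    show "mset (first_fit nb l x [] [] S') = mset (first_fit nb l x [] [] S)"
      if "x \<in> set S" "length S' \<le> K \<and> prefix S S'" for S'
      using that by (auto simp: prefix_def first_fit_append)
    assume "x \<in> set S"
    then show "(1 - 4 * \<epsilon>) * real D \<le> real (size (mset (first_fit nb l x [] [] S)))"
      using lr length_first_fit[of x S "[]" l nb "[]"] lD len[OF x] by force
  next
    fix S p assume S: "S \<in> lists (left_nodes G)" "length S \<le> K"
    \<comment> \<open>With nothing seen and no layers, the second summand vanishes and the first is
      the load of \<open>p\<close>.\<close>
    have "card {x \<in> set S - set []. p \<in> set (first_fit nb l x [] [] S)} +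
        length (filter (\<lambda>T. p \<in> set T) []) \<le> nat (2 * \<lceil>log 2 (real K)\<rceil>)"
      by (rule load_first_fit[where D = D]) (use S len layers[OF S] in auto)
    then show "card {x \<in> set S. p \<in># mset (first_fit nb l x [] [] S)}
        \<le> nat (2 * \<lceil>log 2 (real K)\<rceil>)" by simp
  qed
qed

section \<open>Symbolic evaluation\<close>

text \<open>
  A weakest precondition: its equations below evaluate a program symbolically by rewriting.
\<close>

definition eval_such_that ::
  "expr list \<Rightarrow> tree \<Rightarrow> expr \<Rightarrow> (tree \<Rightarrow> nat \<Rightarrow> bool) \<Rightarrow> bool" where
  "eval_such_that F v e Q \<longleftrightarrow> (\<exists>w t. eval F v e w t \<and> Q w t)"

inductive_cases eval_ArgE: "eval F v Arg w t"
inductive_cases eval_LeafE: "eval F v LeafE w t"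
inductive_cases eval_NodeE: "eval F v (NodeE a b) w t"
inductive_cases eval_LeftE: "eval F v (LeftE a) w t"
inductive_cases eval_RightE: "eval F v (RightE a) w t"
inductive_cases eval_IfE: "eval F v (IfE c a b) w t"
inductive_cases eval_CallE: "eval F v (CallE k a) w t"

lemma eval_such_that_simps:
  "eval_such_that F v Arg Q \<longleftrightarrow> Q v 1"
  "eval_such_that F v LeafE Q \<longleftrightarrow> Q Leaf 1"
  "eval_such_that F v (LeftE a) Q \<longleftrightarrow> eval_such_that F v a (\<lambda>u s. Q (left_part u) (Suc s))"
  "eval_such_that F v (RightE a) Q \<longleftrightarrow> eval_such_that F v a (\<lambda>u s. Q (right_part u) (Suc s))"
  "eval_such_that F v (NodeE a b) Q \<longleftrightarrow>
     eval_such_that F v a (\<lambda>u s. eval_such_that F v b (\<lambda>w t. Q (Node u w) (Suc (s + t))))"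
  "eval_such_that F v (IfE c a b) Q \<longleftrightarrow>
     eval_such_that F v c (\<lambda>u s.
       if u = Leaf then eval_such_that F v b (\<lambda>w t. Q w (Suc (s + t)))
       else eval_such_that F v a (\<lambda>w t. Q w (Suc (s + t))))"
  "eval_such_that F v (CallE k a) Q \<longleftrightarrow>
     eval_such_that F v a (\<lambda>u s. k < length F \<and>
       eval_such_that F u (F ! k) (\<lambda>w t. Q w (Suc (s + t))))"
proof -
  show "eval_such_that F v Arg Q \<longleftrightarrow> Q v 1"
    unfolding eval_such_that_def by (auto intro: eval_Arg[unfolded One_nat_def] elim: eval_ArgE)
  show "eval_such_that F v LeafE Q \<longleftrightarrow> Q Leaf 1"
    unfolding eval_such_that_def by (auto intro: eval_Leaf[unfolded One_nat_def] elim: eval_LeafE)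
  show "eval_such_that F v (LeftE a) Q \<longleftrightarrow> eval_such_that F v a (\<lambda>u s. Q (left_part u) (Suc s))"
    unfolding eval_such_that_def by (blast intro: eval_Left elim: eval_LeftE)
  show "eval_such_that F v (RightE a) Q \<longleftrightarrow> eval_such_that F v a (\<lambda>u s. Q (right_part u) (Suc s))"
    unfolding eval_such_that_def by (blast intro: eval_Right elim: eval_RightE)
  show "eval_such_that F v (NodeE a b) Q \<longleftrightarrow>
     eval_such_that F v a (\<lambda>u s. eval_such_that F v b (\<lambda>w t. Q (Node u w) (Suc (s + t))))"
    unfolding eval_such_that_def by (blast intro: eval_Node elim: eval_NodeE)
  show "eval_such_that F v (IfE c a b) Q \<longleftrightarrow>
     eval_such_that F v c (\<lambda>u s.
       if u = Leaf then eval_such_that F v b (\<lambda>w t. Q w (Suc (s + t)))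
       else eval_such_that F v a (\<lambda>w t. Q w (Suc (s + t))))" (is "?L \<longleftrightarrow> ?R")
  proof
    show "?L \<Longrightarrow> ?R"
      unfolding eval_such_that_def by (elim exE conjE eval_IfE; simp; blast)
    show "?R \<Longrightarrow> ?L"
      unfolding eval_such_that_def
      by (auto split: if_splits intro: eval_If_Node eval_If_Leaf)
  qed
  show "eval_such_that F v (CallE k a) Q \<longleftrightarrow>
     eval_such_that F v a (\<lambda>u s. k < length F \<and>
       eval_such_that F u (F ! k) (\<lambda>w t. Q w (Suc (s + t))))"
    unfolding eval_such_that_def by (blast intro: eval_Call elim: eval_CallE)
qed

text \<open>Determinism turns a known evaluation into a rewrite rule; in this form an induction
  hypothesis replaces a recursive call.\<close>

lemma eval_such_that_eval: "eval F v e w t \<Longrightarrow> eval_such_that F v e Q \<longleftrightarrow> Q w t"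
  unfolding eval_such_that_def using eval_deterministic by blast

lemma computes_within_iff:
  "computes_within (F, e) v w T \<longleftrightarrow> eval_such_that F v e (\<lambda>w' t. w' = w \<and> t \<le> T)"
  by (auto simp: computes_within_def eval_such_that_def)

lemma computes_within_mono: "computes_within P v w s \<Longrightarrow> s \<le> t \<Longrightarrow> computes_within P v w t"
  unfolding computes_within_def by (meson order.trans)

lemma computes_withinE:
  assumes "computes_within (F, e) v w T"
  obtains t where "t \<le> T" "eval F v e w t"
  using assms by (auto simp: computes_within_def)

text \<open>Calls refer to positions, so appending bodies leaves existing evaluations
  intact.\<close>

lemma eval_append: "eval F v e w t \<Longrightarrow> eval (F @ F') v e w t"
  by (induction rule: eval.induct) (auto intro: eval.intros simp: nth_append simp del: One_nat_def)

text \<open>Height instead of the number of nodes: sharing in \<open>NodeE Arg Arg\<close> can make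
  the size exponential in the time, whereas one step raises the height by at most one.\<close>

fun height :: "tree \<Rightarrow> nat" where
  "height Leaf = 0"
| "height (Node a b) = Suc (max (height a) (height b))"

lemma height_eval: "eval F v e w t \<Longrightarrow> height w \<le> height v + t"
proof (induction rule: eval.induct)
  case (eval_Left v a u s) then show ?case by (cases u) auto
next
  case (eval_Right v a u s) then show ?case by (cases u) auto
qed auto

lemma height_enc_string: "length bs \<le> height (enc_string bs)" "height (enc_string bs) \<le> Suc (length bs)"
  by (induction bs) (auto simp: enc_string_def enc_bit_def)


text \<open>The language has no arithmetic, so a counter is a spine on which a function can
  recurse.\<close>

fun unary :: "nat \<Rightarrow> tree" where
  "unary 0 = Leaf"
| "unary (Suc d) = Node Leaf (unary d)"

section \<open>A program for first fit\<close>

text \<open>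
  Arguments are nested pairs: \<open>arg i\<close> is the \<open>i\<close>-th component and \<open>rest i\<close> is what remains
  after the first \<open>i\<close> components. The parameter \<open>m\<close> of a function body is the index of the given
  neighbor program in the list of all functions.
\<close>

fun rest :: "nat \<Rightarrow> expr" where
  "rest 0 = Arg"
| "rest (Suc i) = RightE (rest i)"

fun arg :: "nat \<Rightarrow> expr" where
  "arg i = LeftE (rest (i - 1))"

definition true_expr :: expr where
  "true_expr = NodeE LeafE LeafE"

text \<open>This body and the following ones occupy the positions \<open>m + 1\<close>,
  \<open>m + 2\<close>, ... in the order of \<open>matching_program\<close>. Strings are compared
  bit by bit because the language has no equality test on trees.\<close>

definition eq_body :: "nat \<Rightarrow> expr" where
  "eq_body m =
     (let tails = CallE (m + 1) (NodeE (RightE (arg 1)) (RightE (rest 1)))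
      in IfE (arg 1)
           (IfE (rest 1)
             (IfE (LeftE (arg 1)) (IfE (LeftE (rest 1)) tails LeafE) (IfE (LeftE (rest 1)) LeafE tails))
             LeafE)
           (IfE (rest 1) LeafE true_expr))"

definition member_body :: "nat \<Rightarrow> expr" where
  "member_body m =
     IfE (rest 1)
       (IfE (CallE (m + 1) (NodeE (arg 1) (LeftE (rest 1)))) true_expr
         (CallE (m + 2) (NodeE (arg 1) (RightE (rest 1)))))
       LeafE"

definition inc_body :: "nat \<Rightarrow> expr" where
  "inc_body m =
     IfE Arg
       (IfE (arg 1) (NodeE LeafE (CallE (m + 3) (rest 1))) (NodeE true_expr (rest 1)))
       (NodeE true_expr LeafE)"

definition double_body :: "nat \<Rightarrow> expr" where
  "double_body m = IfE Arg (NodeE LeafE (NodeE LeafE (CallE (m + 4) (rest 1)))) LeafE"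

text \<open>Horner's scheme: the tail is converted and doubled, then the first, least significant
  bit is added.\<close>

definition unary_body :: "nat \<Rightarrow> expr" where
  "unary_body m =
     (let twice = CallE (m + 4) (CallE (m + 5) (rest 1))
      in IfE Arg (IfE (arg 1) (NodeE LeafE twice) twice) LeafE)"

text \<open>The first component is a unary counter that controls the recursion; the second is the
  current index in the binary form expected by the neighbor program.\<close>

definition neighbors_body :: "nat \<Rightarrow> expr" where
  "neighbors_body m =
     IfE (arg 1)
       (NodeE (CallE m (NodeE (rest 2) (arg 2)))
         (CallE (m + 6) (NodeE (RightE (arg 1)) (NodeE (CallE (m + 3) (arg 2)) (rest 2)))))
       LeafE"

definition free_body :: "nat \<Rightarrow> expr" where
  "free_body m =
     IfE (arg 1)
       (IfE (CallE (m + 2) (NodeE (LeftE (arg 1)) (rest 1)))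
         (CallE (m + 7) (NodeE (RightE (arg 1)) (rest 1)))
         (NodeE (LeftE (arg 1)) (CallE (m + 7) (NodeE (RightE (arg 1)) (rest 1)))))
       LeafE"

definition le_length_body :: "nat \<Rightarrow> expr" where
  "le_length_body m =
     IfE (arg 1)
       (IfE (rest 1) (CallE (m + 8) (NodeE (RightE (arg 1)) (RightE (rest 1)))) LeafE)
       true_expr"

definition append_body :: "nat \<Rightarrow> expr" where
  "append_body m =
     IfE (arg 1)
       (NodeE (LeftE (arg 1)) (CallE (m + 9) (NodeE (RightE (arg 1)) (rest 1))))
       (rest 1)"

text \<open>The language has no local binding, so \<open>Z\<close> stands for two separate calls;
  hence the factor 2 in \<open>layers_time\<close>.\<close>

definition extend_body :: "nat \<Rightarrow> expr" where
  "extend_body m =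
     (let Z = CallE (m + 7) (NodeE (arg 2) (arg 3))
      in IfE (rest 2)
           (IfE (CallE (m + 8) (NodeE (arg 1) Z))
             (NodeE (CallE (m + 9) (NodeE Z (arg 3))) (rest 3))
             (NodeE (arg 3) (CallE (m + 10) (NodeE (arg 1) (NodeE (arg 2) (rest 3))))))
           (NodeE (arg 2) LeafE))"

definition choose_body :: "nat \<Rightarrow> expr" where
  "choose_body m =
     (let Z = CallE (m + 7) (NodeE (arg 2) (arg 3))
      in IfE (rest 2)
           (IfE (CallE (m + 8) (NodeE (arg 1) Z)) Z
             (CallE (m + 11) (NodeE (arg 1) (NodeE (arg 2) (rest 3)))))
           (arg 2))"

text \<open>\<open>NodeE true_expr LeafE\<close> is the binary numeral 1, the index of the first
  neighbor.\<close>

definition first_fit_body :: "nat \<Rightarrow> expr" where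
  "first_fit_body m =
     (let d = arg 1; l = arg 2; x = arg 3; seen = arg 4; Ts = arg 5; y = arg 6; ys = rest 6;
        B = CallE (m + 6) (NodeE d (NodeE (NodeE true_expr LeafE) y));
        next = (\<lambda>seen Ts. CallE (m + 12) (NodeE d (NodeE l (NodeE x (NodeE seen (NodeE Ts ys))))))
      in IfE (rest 5)
           (IfE (CallE (m + 2) (NodeE y seen)) (next seen Ts)
             (IfE (CallE (m + 1) (NodeE x y))
               (CallE (m + 11) (NodeE l (NodeE B Ts)))
               (next (NodeE y seen) (CallE (m + 10) (NodeE l (NodeE B Ts))))))
           LeafE)"

text \<open>\<open>arg 3\<close> is the encoded \<open>l\<close>, which is \<open>Leaf\<close>
  exactly for \<open>l = 0\<close>. The two \<open>LeafE\<close> after the node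
  \<open>rest 4\<close> start first fit with no seen nodes and no layers.\<close>

definition main_expr :: "nat \<Rightarrow> expr" where
  "main_expr m =
     IfE (arg 3)
       (CallE (m + 12) (NodeE (CallE (m + 5) (arg 2)) (NodeE (CallE (m + 5) (arg 3))
         (NodeE (rest 4) (NodeE LeafE (NodeE LeafE (arg 4)))))))
       LeafE"

text \<open>The functions of \<open>P\<close> keep their positions, so its calls stay valid; its
  main expression becomes function \<open>m\<close>.\<close>

definition matching_program :: "program \<Rightarrow> program" where
  "matching_program P =
     (let m = length (fst P)
      in (fst P @ [snd P, eq_body m, member_body m, inc_body m, double_body m, unary_body m,
            neighbors_body m, free_body m, le_length_body m, append_body m, extend_body m,
            choose_body m, first_fit_body m],
          main_expr m))"

lemma rest_numeral: "rest (numeral k) = RightE (rest (pred_numeral k))"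
  by (simp add: numeral_eq_Suc)

lemma enc_string_simps:
  "enc_string [] = Leaf" "enc_string (b # bs) = Node (enc_bit b) (enc_string bs)"
  by (simp_all add: enc_string_def)

lemma enc_bit_eq_Leaf: "enc_bit b = Leaf \<longleftrightarrow> \<not> b"
  by (simp add: enc_bit_def)

lemmas expr_simps =
  eval_such_that_simps true_expr_def Let_def rest_numeral enc_string_simps enc_bit_eq_Leaf


section \<open>Time bounds and growth of the layers\<close>

text \<open>Polymorphic, so that a bound on numbers can be turned into a polynomial.\<close>

definition free_time :: "'a::comm_semiring_1 \<Rightarrow> 'a" where
  "free_time M = (M + 1) * ((M + 1) * (40 * (M + 1) + 40) + 40)"

definition layers_time :: "'a::comm_semiring_1 \<Rightarrow> 'a" where
  "layers_time M = (M + 1) * (2 * free_time M + 80 * (M + 1) + 100)"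

text \<open>The summands pay for membership in \<open>seen\<close>, comparison with
  \<open>x\<close>, listing the neighbors, one pass over the layers and the remaining elementary
  steps. \<open>M\<close> bounds all lengths and the time of the neighbor program.\<close>

definition step_time :: "'a::comm_semiring_1 \<Rightarrow> 'a" where
  "step_time M =
     (M + 1) * (40 * (M + 1) + 40) + 40 * (M + 1) + (M + 1) * (M + 40 * (M + 2) + 40) +
     layers_time M + 200"

lemma length_extend_layers: "length (extend_layers l B Ts) \<le> Suc (length Ts)"
  by (induction Ts) (auto simp: Let_def)

text \<open>Each processed node lengthens a layer by at most \<open>length B\<close>, which keeps
  the state of polynomial size.\<close>

lemma length_extend_layers_element:
  assumes "\<And>U. U \<in> set Ts \<Longrightarrow> length U \<le> k" "U \<in> set (extend_layers l B Ts)"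
  shows "length U \<le> k + length B"
  using assms
proof (induction Ts)
  case (Cons T Ts)
  define Z where "Z = filter (\<lambda>p. p \<notin> set T) B"
  have Z: "length Z \<le> length B" by (simp add: Z_def)
  have T: "length T \<le> k" by (simp add: Cons.prems(1))
  consider "U = Z @ T" | "U \<in> set (T # Ts)" | "U \<in> set (extend_layers l B Ts)"
    using Cons.prems(2) by (auto simp: Let_def Z_def split: if_splits)
  then show ?case
  proof cases
    case 1
    then show ?thesis using Z T by simp
  next
    case 2
    then show ?thesis using Cons.prems(1) trans_le_add1 by blast
  next
    case 3
    then show ?thesis using Cons.IH Cons.prems(1) by simp
  qed
qed simp

section \<open>Correctness and running time of the function bodies\<close>

context
  fixes P :: program and m :: nat and F :: "expr list"
  defines "m \<equiv> length (fst P)" and "F \<equiv> fst (matching_program P)"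
begin

private lemma F_nth [simp]:
  "F ! m = snd P" "F ! (Suc m) = eq_body m" "F ! (Suc (Suc m)) = member_body m"
  "F ! (m + 3) = inc_body m" "F ! (m + 4) = double_body m" "F ! (m + 5) = unary_body m"
  "F ! (m + 6) = neighbors_body m" "F ! (m + 7) = free_body m" "F ! (m + 8) = le_length_body m"
  "F ! (m + 9) = append_body m" "F ! (m + 10) = extend_body m" "F ! (m + 11) = choose_body m"
  "F ! (m + 12) = first_fit_body m" "length F = m + 13"
  unfolding F_def m_def matching_program_def Let_def fst_conv
  by (simp_all add: nth_append)

lemma computes_within_given_program:
  "computes_within P v w T \<Longrightarrow> computes_within (F, snd P) v w T"
  by (auto simp: computes_within_def F_def matching_program_def Let_def intro: eval_append)


text \<open>Each level of the recursion takes a constant number of elementary steps, for which 40 is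
  a generous allowance.\<close>

lemma computes_within_eq:
  "computes_within (F, eq_body m) (Node (enc_string a) (enc_string b)) (enc_bit (a = b))
     (40 * (length a + 1))"
proof (induction a arbitrary: b)
  case Nil
  show ?case
    unfolding computes_within_iff eq_body_def by (cases b) (simp_all add: expr_simps enc_bit_def)
next
  case (Cons x a)
  show ?case
  proof (cases b)
    case Nil
    show ?thesis
      unfolding Nil computes_within_iff eq_body_def by (simp add: expr_simps enc_bit_def)
  next
    case b: (Cons y b')
    obtain t where t: "t \<le> 40 * (length a + 1)"
        "eval F (Node (enc_string a) (enc_string b')) (eq_body m)
           (enc_bit (a = b')) t"
      by (rule computes_withinE[OF Cons.IH])
    show ?thesis
      unfolding b computes_within_iff
      by (subst eq_body_def, cases x; cases y) (use t(1) in \<open>simp_all add: expr_simps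
          eval_such_that_eval[OF t(2)] enc_bit_def\<close>)
  qed
qed

abbreviation enc_strings :: "bool list list \<Rightarrow> tree" where
  "enc_strings \<equiv> enc_list enc_string"

text \<open>A comparison ends with the shorter string at the latest, so the length of
  \<open>a\<close> alone bounds its cost and the elements of \<open>bs\<close> may be arbitrarily
  long.\<close>

lemma computes_within_member:
  assumes "length a \<le> s"
  shows "computes_within (F, member_body m) (Node (enc_string a) (enc_strings bs))
    (enc_bit (a \<in> set bs)) ((length bs + 1) * (40 * (s + 1) + 40))"
proof (induction bs)
  case Nil
  show ?case unfolding computes_within_iff member_body_def by (simp add: expr_simps enc_bit_def)
next
  case (Cons b bs)
  obtain t where t: "t \<le> (length bs + 1) * (40 * (s + 1) + 40)"
      "eval F (Node (enc_string a) (enc_strings bs)) (member_body m)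
           (enc_bit (a \<in> set bs)) t"
    by (rule computes_withinE[OF Cons.IH])
  obtain t' where t': "t' \<le> 40 * (length a + 1)"
      "eval F (Node (enc_string a) (enc_string b)) (eq_body m)
           (enc_bit (a = b)) t'"
    by (rule computes_withinE[OF computes_within_eq])
  show ?case
    unfolding computes_within_iff
    by (subst member_body_def) (use t(1) t'(1) assms in \<open>simp add: expr_simps
        eval_such_that_eval[OF t(2)] eval_such_that_eval[OF t'(2)] enc_bit_def\<close>)
qed

text \<open>The carry runs along the bits, hence induction through \<open>i div 2\<close>. The
  linear bound is crude but suffices for indices up to \<open>D\<close>.\<close>

lemma computes_within_inc:
  "computes_within (F, inc_body m) (enc_nat i) (enc_nat (Suc i)) (40 * (i + 1))"
proof (induction i rule: less_induct)
  case (less i)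
  show ?case
  proof (cases "i = 0")
    case True
    then show ?thesis
      unfolding computes_within_iff inc_body_def enc_nat_def
      by (simp add: expr_simps nat_bits.simps[of 0] nat_bits.simps[of "Suc 0"] enc_bit_def)
  next
    case False
    then obtain t where t: "t \<le> 40 * (i div 2 + 1)"
        "eval F (enc_nat (i div 2)) (inc_body m)
           (enc_nat (Suc (i div 2))) t"
      using computes_withinE[OF less[of "i div 2"]]
      by (metis div_less_dividend gr0I one_less_numeral_iff semiring_norm(76))
    have i: "nat_bits i = odd i # nat_bits (i div 2)"
        "nat_bits (Suc i) = even i # nat_bits (Suc i div 2)"
      using False by (simp_all add: nat_bits.simps[of i] nat_bits.simps[of "Suc i"])
    show ?thesis
    proof (cases "odd i")
      case True
      have "2 * (i div 2) \<le> i" by simp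
      then have "t + 20 \<le> 40 * (i + 1)" using t(1) \<open>i \<noteq> 0\<close> by simp
      moreover have "Suc i div 2 = Suc (i div 2)" using True by presburger
      ultimately show ?thesis
        using True unfolding computes_within_iff enc_nat_def
        by (subst inc_body_def) (simp add: expr_simps i
            eval_such_that_eval[OF t(2)[unfolded enc_nat_def]] enc_bit_def)
    next
      case False
      moreover have "Suc i div 2 = i div 2" using False by presburger
      ultimately show ?thesis
        unfolding computes_within_iff enc_nat_def inc_body_def
        by (simp add: expr_simps i enc_bit_def)
    qed
  qed
qed

lemma computes_within_double:
  "computes_within (F, double_body m) (unary d) (unary (2 * d)) (40 * (d + 1))"
proof (induction d)
  case 0
  show ?case unfolding computes_within_iff double_body_def by (simp add: expr_simps)
next
  case (Suc d)
  obtain t where t: "t \<le> 40 * (d + 1)"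
      "eval F (unary d) (double_body m)
           (unary (2 * d)) t"
    by (rule computes_withinE[OF Suc.IH])
  show ?case
    unfolding computes_within_iff
    by (subst double_body_def) (use t(1) in \<open>simp add: expr_simps
        eval_such_that_eval[OF t(2)]\<close>)
qed

text \<open>Doubling takes time linear in its argument, and the arguments halve from level to level,
  so the costs form a geometric series.\<close>

lemma computes_within_unary:
  "computes_within (F, unary_body m) (enc_nat d) (unary d) (100 * (2 * d + 1))"
proof (induction d rule: less_induct)
  case (less d)
  show ?case
  proof (cases "d = 0")
    case True
    then show ?thesis
      unfolding computes_within_iff unary_body_def enc_nat_def
      by (simp add: expr_simps nat_bits.simps[of 0])
  next
    case False
    define h where "h = d div 2"
    have "h < d" using False by (simp add: h_def)
    then obtain t where t: "t \<le> 100 * (2 * h + 1)"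
        "eval F (enc_nat h) (unary_body m)
           (unary h) t"
      using computes_withinE[OF less[of h]] by metis
    obtain t' where t': "t' \<le> 40 * (h + 1)"
        "eval F (unary h) (double_body m)
           (unary (2 * h)) t'"
      by (rule computes_withinE[OF computes_within_double])
    have d: "nat_bits d = odd d # nat_bits h"
      using False by (simp add: nat_bits.simps[of d] h_def)
    have u: "unary d = (if odd d then Node Leaf (unary (2 * h)) else unary (2 * h))"
      by (cases "odd d") (auto simp: h_def elim!: oddE)
    have "2 * h \<le> d" by (simp add: h_def)
    then have "t + t' + 20 \<le> 100 * (2 * d + 1)" using t(1) t'(1) \<open>h < d\<close> by simp
    then show ?thesis
      unfolding computes_within_iff enc_nat_def
      by (subst unary_body_def)
        (simp add: expr_simps d u eval_such_that_eval[OF t(2)[unfolded enc_nat_def]]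
            eval_such_that_eval[OF t'(2)])
  qed
qed

text \<open>General in the first index \<open>i\<close>, which grows as the counter \<open>d\<close>
  shrinks; their sum, which enters the bound, stays constant.\<close>

lemma computes_within_neighbors:
  assumes "\<And>j. i \<le> j \<Longrightarrow> j < i + d \<Longrightarrow>
    computes_within P (Node (enc_string x) (enc_nat j)) (enc_string (nb j)) T"
  shows "computes_within (F, neighbors_body m) (Node (unary d) (Node (enc_nat i) (enc_string x)))
    (enc_strings (map nb [i..<i + d])) ((d + 1) * (T + 40 * (i + d + 1) + 40))"
  using assms
proof (induction d arbitrary: i)
  case 0
  show ?case unfolding computes_within_iff neighbors_body_def by (simp add: expr_simps)
next
  case (Suc d)
  have "computes_within (F, neighbors_body m) (Node (unary d) (Node (enc_nat (Suc i)) (enc_string x)))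
      (enc_strings (map nb [Suc i..<Suc i + d])) ((d + 1) * (T + 40 * (Suc i + d + 1) + 40))"
    by (rule Suc.IH) (use Suc.prems in auto)
  then obtain t where t: "t \<le> (d + 1) * (T + 40 * (Suc i + d + 1) + 40)"
      "eval F (Node (unary d) (Node (enc_nat (Suc i)) (enc_string x))) (neighbors_body m)
           (enc_strings (map nb [Suc i..<Suc i + d])) t"
    by (rule computes_withinE)
  obtain t' where t': "t' \<le> T"
      "eval F (Node (enc_string x) (enc_nat i)) (snd P)
           (enc_string (nb i)) t'"
    using computes_withinE[OF computes_within_given_program[OF Suc.prems[of i]]]
    by (metis add_Suc_right le_add1 less_Suc_eq_le order.refl)
  obtain t'' where t'': "t'' \<le> 40 * (i + 1)"
      "eval F (enc_nat i) (inc_body m)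
           (enc_nat (Suc i)) t''"
    by (rule computes_withinE[OF computes_within_inc])
  have "t + t' + t'' + 40 \<le> (Suc d + 1) * (T + 40 * (i + Suc d + 1) + 40)"
    using t(1) t'(1) t''(1) by simp
  then show ?case
    unfolding computes_within_iff
    by (subst neighbors_body_def)
      (simp add: expr_simps eval_such_that_eval[OF t(2)] eval_such_that_eval[OF t'(2)]
          eval_such_that_eval[OF t''(2)] upt_conv_Cons del: upt_Suc)
qed

lemma computes_within_free:
  assumes "\<And>b. b \<in> set B \<Longrightarrow> length b \<le> s"
  shows "computes_within (F, free_body m) (Node (enc_strings B) (enc_strings U))
    (enc_strings (filter (\<lambda>p. p \<notin> set U) B))
    ((length B + 1) * ((length U + 1) * (40 * (s + 1) + 40) + 40))"
  using assms
proof (induction B)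
  case Nil
  show ?case unfolding computes_within_iff free_body_def by (simp add: expr_simps)
next
  case (Cons b B)
  define T where "T = (length U + 1) * (40 * (s + 1) + 40)"
  obtain t where t: "t \<le> (length B + 1) * (T + 40)"
      "eval F (Node (enc_strings B) (enc_strings U)) (free_body m)
           (enc_strings (filter (\<lambda>p. p \<notin> set U) B)) t"
    using computes_withinE[OF Cons.IH] Cons.prems unfolding T_def by (metis list.set_intros(2))
  obtain t' where t': "t' \<le> T"
      "eval F (Node (enc_string b) (enc_strings U)) (member_body m)
           (enc_bit (b \<in> set U)) t'"
    using computes_withinE[OF computes_within_member] Cons.prems unfolding T_def
    by (metis list.set_intros(1))
  show ?case
    unfolding computes_within_iff T_def[symmetric]
    by (subst free_body_def) (use t(1) t'(1) in \<open>simp add: expr_simps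
        eval_such_that_eval[OF t(2)] eval_such_that_eval[OF t'(2)]\<close>)
qed

lemma computes_within_le_length:
  "computes_within (F, le_length_body m) (Node (unary l) (enc_list enc B))
     (enc_bit (l \<le> length B)) (40 * (length B + 1))"
proof (induction B arbitrary: l)
  case Nil
  show ?case
    unfolding computes_within_iff le_length_body_def
    by (cases l) (simp_all add: expr_simps enc_bit_def)
next
  case (Cons b B)
  show ?case
  proof (cases l)
    case 0
    show ?thesis
      unfolding 0 computes_within_iff le_length_body_def by (simp add: expr_simps enc_bit_def)
  next
    case l: (Suc l')
    obtain t where t: "t \<le> 40 * (length B + 1)"
        "eval F (Node (unary l') (enc_list enc B)) (le_length_body m)
           (enc_bit (l' \<le> length B)) t"
      by (rule computes_withinE[OF Cons.IH])
    show ?thesis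
      unfolding l computes_within_iff
      by (subst le_length_body_def) (use t(1) in \<open>simp add: expr_simps
          eval_such_that_eval[OF t(2)]\<close>)
  qed
qed

lemma computes_within_append:
  "computes_within (F, append_body m) (Node (enc_list enc A) (enc_list enc B))
     (enc_list enc (A @ B)) (40 * (length A + 1))"
proof (induction A)
  case Nil
  show ?case unfolding computes_within_iff append_body_def by (simp add: expr_simps)
next
  case (Cons a A)
  obtain t where t: "t \<le> 40 * (length A + 1)"
      "eval F (Node (enc_list enc A) (enc_list enc B)) (append_body m)
           (enc_list enc (A @ B)) t"
    by (rule computes_withinE[OF Cons.IH])
  show ?case
    unfolding computes_within_iff
    by (subst append_body_def) (use t(1) in \<open>simp add: expr_simps
        eval_such_that_eval[OF t(2)]\<close>)
qed


section \<open>Running time of the layer operations and of the whole program\<close>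

abbreviation enc_layers :: "bool list list list \<Rightarrow> tree" where
  "enc_layers \<equiv> enc_list enc_strings"

lemma computes_within_free_bounded:
  assumes "length B \<le> M" "length U \<le> M" "\<And>b. b \<in> set B \<Longrightarrow> length b \<le> M"
  shows "computes_within (F, free_body m) (Node (enc_strings B) (enc_strings U))
    (enc_strings (filter (\<lambda>p. p \<notin> set U) B)) (free_time M)"
  unfolding free_time_def
  by (rule computes_within_mono[OF computes_within_free[of B M]])
    (use assms in \<open>auto intro!: mult_mono add_mono\<close>)

lemma computes_within_extend:
  assumes "length B \<le> M" "\<And>b. b \<in> set B \<Longrightarrow> length b \<le> M"
    and "\<And>U. U \<in> set Ts \<Longrightarrow> length U \<le> M"
  shows "computes_within (F, extend_body m)
    (Node (unary l) (Node (enc_strings B) (enc_layers Ts)))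
    (enc_layers (extend_layers l B Ts))
    ((length Ts + 1) * (2 * free_time M + 80 * (M + 1) + 100))"
  using assms(3)
proof (induction Ts)
  case Nil
  show ?case unfolding computes_within_iff extend_body_def by (simp add: expr_simps)
next
  case (Cons U Ts)
  define Z where "Z = filter (\<lambda>p. p \<notin> set U) B"
  have Z: "length Z \<le> M" using assms(1) length_filter_le[of _ B] unfolding Z_def by (rule order.trans[rotated])
  obtain t where t: "t \<le> (length Ts + 1) * (2 * free_time M + 80 * (M + 1) + 100)"
      "eval F (Node (unary l) (Node (enc_strings B) (enc_layers Ts))) (extend_body m)
           (enc_layers (extend_layers l B Ts)) t"
    using computes_withinE[OF Cons.IH] Cons.prems by (metis list.set_intros(2))
  obtain t1 where t1: "t1 \<le> free_time M"
      "eval F (Node (enc_strings B) (enc_strings U)) (free_body m)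
           (enc_strings Z) t1"
    using computes_withinE[OF computes_within_free_bounded] assms(1,2) Cons.prems unfolding Z_def
    by (metis list.set_intros(1))
  obtain t2 where t2: "t2 \<le> 40 * (length Z + 1)"
      "eval F (Node (unary l) (enc_strings Z)) (le_length_body m)
           (enc_bit (l \<le> length Z)) t2"
    by (rule computes_withinE[OF computes_within_le_length])
  obtain t3 where t3: "t3 \<le> 40 * (length Z + 1)"
      "eval F (Node (enc_strings Z) (enc_strings U)) (append_body m)
           (enc_strings (Z @ U)) t3"
    by (rule computes_withinE[OF computes_within_append])
  show ?case
    unfolding computes_within_iff
    by (subst extend_body_def)
      (use t(1) t1(1) t2(1) t3(1) Z in
        \<open>simp add: expr_simps eval_such_that_eval[OF t(2)] eval_such_that_eval[OF t1(2)]
            eval_such_that_eval[OF t2(2)] eval_such_that_eval[OF t3(2)] Z_def[symmetric]\<close>)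
qed

lemma computes_within_choose:
  assumes "length B \<le> M" "\<And>b. b \<in> set B \<Longrightarrow> length b \<le> M"
    and "\<And>U. U \<in> set Ts \<Longrightarrow> length U \<le> M"
  shows "computes_within (F, choose_body m)
    (Node (unary l) (Node (enc_strings B) (enc_layers Ts)))
    (enc_strings (choose_layer l B Ts))
    ((length Ts + 1) * (2 * free_time M + 80 * (M + 1) + 100))"
  using assms(3)
proof (induction Ts)
  case Nil
  show ?case unfolding computes_within_iff choose_body_def by (simp add: expr_simps)
next
  case (Cons U Ts)
  define Z where "Z = filter (\<lambda>p. p \<notin> set U) B"
  have Z: "length Z \<le> M" using assms(1) length_filter_le[of _ B] unfolding Z_def by (rule order.trans[rotated])
  obtain t where t: "t \<le> (length Ts + 1) * (2 * free_time M + 80 * (M + 1) + 100)"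
      "eval F (Node (unary l) (Node (enc_strings B) (enc_layers Ts))) (choose_body m)
           (enc_strings (choose_layer l B Ts)) t"
    using computes_withinE[OF Cons.IH] Cons.prems by (metis list.set_intros(2))
  obtain t1 where t1: "t1 \<le> free_time M"
      "eval F (Node (enc_strings B) (enc_strings U)) (free_body m)
           (enc_strings Z) t1"
    using computes_withinE[OF computes_within_free_bounded] assms(1,2) Cons.prems unfolding Z_def
    by (metis list.set_intros(1))
  obtain t2 where t2: "t2 \<le> 40 * (length Z + 1)"
      "eval F (Node (unary l) (enc_strings Z)) (le_length_body m)
           (enc_bit (l \<le> length Z)) t2"
    by (rule computes_withinE[OF computes_within_le_length])
  show ?case
    unfolding computes_within_iff
    by (subst choose_body_def)
      (use t(1) t1(1) t2(1) Z in
        \<open>simp add: expr_simps eval_such_that_eval[OF t(2)] eval_such_that_eval[OF t1(2)]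
            eval_such_that_eval[OF t2(2)] Z_def[symmetric]\<close>)
qed

text \<open>The size hypotheses bound the current state plus what the remaining input may add. A
  step uses up one node of \<open>S\<close> and adds at most one seen node, one layer and
  \<open>D\<close> elements to a layer, so they pass on to the recursive calls.\<close>

lemma computes_within_first_fit:
  assumes nb: "\<And>y i. y \<in> set S \<Longrightarrow> 1 \<le> i \<Longrightarrow> i \<le> D \<Longrightarrow>
      computes_within P (Node (enc_string y) (enc_nat i)) (enc_string (nb y i)) M"
    "\<And>y i. y \<in> set S \<Longrightarrow> 1 \<le> i \<Longrightarrow> i \<le> D \<Longrightarrow> length (nb y i) \<le> M"
    and "\<And>y. y \<in> set S \<Longrightarrow> length y \<le> M" "length x \<le> M" "D \<le> M" "D * length S \<le> M"
    and "length seen + length S \<le> M" "length Ts + length S \<le> M"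
    and "\<And>U. U \<in> set Ts \<Longrightarrow> length U + D * length S \<le> M"
  shows "computes_within (F, first_fit_body m)
    (Node (unary D) (Node (unary l) (Node (enc_string x)
      (Node (enc_strings seen) (Node (enc_layers Ts) (enc_strings S))))))
    (enc_strings (first_fit (\<lambda>y. map (nb y) [1..<Suc D]) l x seen Ts S))
    ((length S + 1) * step_time M)"
  using assms
proof (induction S arbitrary: seen Ts)
  case Nil
  show ?case
    unfolding computes_within_iff first_fit_body_def by (simp add: expr_simps step_time_def)
next
  case (Cons y ys)
  let ?B = "map (nb y) [1..<Suc D]"
  let ?Ts = "extend_layers l ?B Ts"
  let ?fit = "first_fit (\<lambda>y. map (nb y) [1..<Suc D]) l x"
  let ?inp = "\<lambda>seen Ts. Node (unary D) (Node (unary l) (Node (enc_string x)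
      (Node (enc_strings seen) (Node (enc_layers Ts) (enc_strings ys)))))"
  have B: "length ?B \<le> M" "\<And>b. b \<in> set ?B \<Longrightarrow> length b \<le> M"
    using Cons.prems(2,5) by auto
  have Ts: "length U \<le> M" if "U \<in> set Ts" for U
    using Cons.prems(9)[OF that] by simp
  have len: "length Ts \<le> M" "length seen \<le> M" "length y \<le> M"
    using Cons.prems(3,7,8) by auto
  have len': "length U + D * length ys \<le> M" if "U \<in> set ?Ts" for U
  proof -
    \<comment> \<open>The subtraction does not truncate, since
      \<open>D * length (y # ys) \<le> M\<close>.\<close>
    have "length U \<le> (M - D * length (y # ys)) + length ?B"
      by (rule length_extend_layers_element[OF _ that])
        (use Cons.prems(6,9) in \<open>auto simp: le_diff_conv2\<close>)
    then show ?thesis using Cons.prems(6) by (simp del: upt_Suc)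
  qed
  note ys = Cons.prems(1-3)[OF list.set_intros(2)]
  have D: "D * length ys \<le> M" using Cons.prems(6) by simp
  have "computes_within (F, first_fit_body m) (?inp seen Ts) (enc_strings (?fit seen Ts ys))
      ((length ys + 1) * step_time M)"
  proof (rule Cons.IH[OF ys Cons.prems(4,5) D])
    fix U assume "U \<in> set Ts"
    then show "length U + D * length ys \<le> M" using Cons.prems(9) by fastforce
  qed (use Cons.prems(7,8) in simp_all)
  then obtain t1 where t1: "t1 \<le> (length ys + 1) * step_time M"
      "eval F (?inp seen Ts) (first_fit_body m)
           (enc_strings (?fit seen Ts ys)) t1"
    by (rule computes_withinE)
  have "computes_within (F, first_fit_body m) (?inp (y # seen) ?Ts)
      (enc_strings (?fit (y # seen) ?Ts ys)) ((length ys + 1) * step_time M)"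
    by (rule Cons.IH[OF ys Cons.prems(4,5) D _ _ len'])
      (use Cons.prems(7,8) length_extend_layers[of l ?B Ts] in \<open>simp_all del: upt_Suc\<close>)
  then obtain t2 where t2: "t2 \<le> (length ys + 1) * step_time M"
      "eval F (?inp (y # seen) ?Ts) (first_fit_body m)
           (enc_strings (?fit (y # seen) ?Ts ys)) t2"
    by (rule computes_withinE)
  have "(length seen + 1) * (40 * (M + 1) + 40) \<le> (M + 1) * (40 * (M + 1) + 40)"
    using len by (intro mult_right_mono) auto
  then obtain t3 where t3: "t3 \<le> (M + 1) * (40 * (M + 1) + 40)"
      "eval F (Node (enc_string y) (enc_strings seen)) (member_body m)
           (enc_bit (y \<in> set seen)) t3"
    by (rule computes_withinE[OF computes_within_mono[OF computes_within_member[OF len(3)]]])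
  obtain t4 where t4: "t4 \<le> 40 * (length x + 1)"
      "eval F (Node (enc_string x) (enc_string y)) (eq_body m)
           (enc_bit (x = y)) t4"
    by (rule computes_withinE[OF computes_within_eq])
  have neighbors: "computes_within (F, neighbors_body m)
      (Node (unary D) (Node (enc_nat 1) (enc_string y)))
      (enc_strings (map (nb y) [1..<1 + D])) ((D + 1) * (M + 40 * (1 + D + 1) + 40))"
    by (rule computes_within_neighbors) (use Cons.prems(1) in auto)
  have "(D + 1) * (M + 40 * (1 + D + 1) + 40) \<le> (M + 1) * (M + 40 * (M + 2) + 40)"
    using Cons.prems(5) by (intro mult_mono) auto
  from computes_within_mono[OF neighbors this] obtain t5 where t5: "t5 \<le> (M + 1) * (M + 40 * (M + 2) + 40)"
      "eval F (Node (unary D) (Node (enc_nat 1) (enc_string y))) (neighbors_body m)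
           (enc_strings ?B) t5"
    unfolding plus_1_eq_Suc by (rule computes_withinE)
  have layers: "(length Ts + 1) * (2 * free_time M + 80 * (M + 1) + 100) \<le> layers_time M"
    unfolding layers_time_def using len by (intro mult_right_mono) auto
  obtain t6 where t6: "t6 \<le> layers_time M"
      "eval F (Node (unary l) (Node (enc_strings ?B) (enc_layers Ts))) (extend_body m)
           (enc_layers ?Ts) t6"
    by (rule computes_withinE[OF computes_within_mono[OF computes_within_extend[OF B Ts] layers]])
  obtain t7 where t7: "t7 \<le> layers_time M"
      "eval F (Node (unary l) (Node (enc_strings ?B) (enc_layers Ts))) (choose_body m)
           (enc_strings (choose_layer l ?B Ts)) t7"
    by (rule computes_withinE[OF computes_within_mono[OF computes_within_choose[OF B Ts] layers]])
  \<comment> \<open>The program contains the numeral 1 as a literal tree, which evaluation produces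
    in place of \<open>enc_nat 1\<close>.\<close>
  have enc_1: "enc_nat 1 = Node (Node Leaf Leaf) Leaf"
    by (simp add: enc_nat_def nat_bits.simps[of 0] nat_bits.simps[of "Suc 0"]
        enc_string_simps enc_bit_def)
  \<comment> \<open>Naming the products makes the remaining arithmetic linear.\<close>
  define a c e where "a = (M + 1) * (40 * (M + 1) + 40)"
    and "c = (M + 1) * (M + 40 * (M + 2) + 40)" and "e = (length ys + 1) * step_time M"
  have step: "step_time M = a + 40 * (M + 1) + c + layers_time M + 200"
    by (simp only: step_time_def a_def c_def)
  have total: "(length (y # ys) + 1) * step_time M = step_time M + e"
    by (simp add: e_def)
  \<comment> \<open>The three branches: \<open>y\<close> seen before, \<open>y = x\<close>, and a
    new \<open>y\<close> other than \<open>x\<close>.\<close>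
  have "t1 + t3 + 200 \<le> step_time M + e" "t7 + t5 + t4 + t3 + 200 \<le> step_time M + e"
      "t2 + t6 + t5 + t4 + t3 + 200 \<le> step_time M + e"
    using t1(1)[folded e_def] t2(1)[folded e_def] t3(1)[folded a_def] t4(1) t5(1)[folded c_def]
      t6(1) t7(1) Cons.prems(4)
    by (simp_all add: step)
  then show ?case
    unfolding computes_within_iff total
    by (subst first_fit_body_def)
      (simp add: expr_simps eval_such_that_eval[OF t1(2)]
          eval_such_that_eval[OF t2(2)[unfolded One_nat_def enc_list.simps]]
          eval_such_that_eval[OF t3(2)] eval_such_that_eval[OF t4(2)]
          eval_such_that_eval[OF t5(2)[unfolded enc_1]]
          eval_such_that_eval[OF t6(2)[unfolded One_nat_def]]
          eval_such_that_eval[OF t7(2)[unfolded One_nat_def]] del: upt_Suc)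
qed

lemma computes_within_matching_program:
  assumes nb: "\<And>y i. y \<in> set S \<Longrightarrow> 1 \<le> i \<Longrightarrow> i \<le> D \<Longrightarrow>
      computes_within P (Node (enc_string y) (enc_nat i)) (enc_string (nb y i)) M"
    "\<And>y i. y \<in> set S \<Longrightarrow> 1 \<le> i \<Longrightarrow> i \<le> D \<Longrightarrow> length (nb y i) \<le> M"
    and "\<And>y. y \<in> set S \<Longrightarrow> length y \<le> M" "length x \<le> M" "D \<le> M" "l \<le> M"
    and "length S \<le> M" "D * length S \<le> M"
  shows "computes_within (matching_program P) (enc_matching_input K D l S x)
    (enc_strings (if l = 0 then [] else first_fit (\<lambda>y. map (nb y) [1..<Suc D]) l x [] [] S))
    ((M + 1) * step_time M + 400 * (M + 1))"
proof -
  have P: "matching_program P = (F, main_expr m)"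
    by (simp add: F_def m_def matching_program_def Let_def)
  have l: "enc_nat l = Leaf \<longleftrightarrow> l = 0"
    by (simp add: enc_nat_def nat_bits.simps[of l] enc_string_simps)
  have "computes_within (F, first_fit_body m)
    (Node (unary D) (Node (unary l) (Node (enc_string x)
      (Node (enc_strings []) (Node (enc_layers []) (enc_strings S))))))
    (enc_strings (first_fit (\<lambda>y. map (nb y) [1..<Suc D]) l x [] [] S))
    ((length S + 1) * step_time M)"
    by (rule computes_within_first_fit) (use assms in auto)
  from computes_within_mono[OF this, of "(M + 1) * step_time M"]
  have "computes_within (F, first_fit_body m)
    (Node (unary D) (Node (unary l) (Node (enc_string x) (Node Leaf (Node Leaf (enc_strings S))))))
    (enc_strings (first_fit (\<lambda>y. map (nb y) [1..<Suc D]) l x [] [] S)) ((M + 1) * step_time M)"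
    using assms(7) by (simp add: mult_right_mono del: upt_Suc)
  then obtain t where t: "t \<le> (M + 1) * step_time M"
      "eval F (Node (unary D) (Node (unary l) (Node (enc_string x) (Node Leaf (Node Leaf (enc_strings S)))))) (first_fit_body m)
           (enc_strings (first_fit (\<lambda>y. map (nb y) [1..<Suc D]) l x [] [] S)) t"
    by (rule computes_withinE)
  obtain t1 where t1: "t1 \<le> 100 * (2 * D + 1)"
      "eval F (enc_nat D) (unary_body m)
           (unary D) t1"
    by (rule computes_withinE[OF computes_within_unary])
  obtain t2 where t2: "t2 \<le> 100 * (2 * l + 1)"
      "eval F (enc_nat l) (unary_body m)
           (unary l) t2"
    by (rule computes_withinE[OF computes_within_unary])
  define s where "s = (M + 1) * step_time M"
  \<comment> \<open>Converting \<open>D\<close> and \<open>l\<close> to unary takes at most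
    \<open>400 * M + 200\<close> steps, which leaves room for the rest of the main
    expression.\<close>
  have "t + t1 + t2 + 100 \<le> s + 400 * (M + 1)"
    using t(1)[folded s_def] t1(1) t2(1) assms(5,6) by simp
  then show ?thesis
    unfolding P computes_within_iff enc_matching_input_def main_expr_def s_def[symmetric]
    by (simp add: expr_simps l eval_such_that_eval[OF t(2)] eval_such_that_eval[OF t1(2)]
        eval_such_that_eval[OF t2(2)] del: upt_Suc)
qed

end

section \<open>Explicit families\<close>

text \<open>Natural coefficients are nonnegative.\<close>

lemma poly_nat_mono:
  fixes p :: "nat poly"
  assumes "a \<le> b"
  shows "poly p a \<le> poly p b"
proof (induction p)
  case (pCons c p)
  then show ?case using assms by (simp add: mult_mono)
qed simp

lemma length_nat_bits: "length (nat_bits i) \<le> i"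
proof (induction i rule: less_induct)
  case (less i)
  show ?case
  proof (cases "i = 0")
    case True
    then show ?thesis by (simp add: nat_bits.simps[of 0])
  next
    case False
    then have "length (nat_bits (i div 2)) \<le> i div 2" by (intro less) simp
    moreover have "length (nat_bits i) = Suc (length (nat_bits (i div 2)))"
      using False by (simp add: nat_bits.simps[of i])
    ultimately show ?thesis using False by presburger
  qed
qed

text \<open>Explicitness bounds only the time of the neighbor program; height converts time into a
  bound on the length of the right nodes.\<close>

lemma length_computed_neighbor:
  assumes "computes_within P (Node (enc_string x) (enc_nat i)) (enc_string z) T"
  shows "length z \<le> length x + i + 2 + T"
proof -
  have "length z \<le> height (Node (enc_string x) (enc_nat i)) + T"
    using assms height_enc_string(1)[of z] height_eval unfolding computes_within_def
    by (meson add_left_mono order.trans)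
  also have "height (Node (enc_string x) (enc_nat i)) \<le> length x + i + 2"
    using height_enc_string(2)[of x] height_enc_string(2)[of "nat_bits i"] length_nat_bits[of i]
    by (simp add: enc_nat_def)
  finally show ?thesis by simp
qed

lemma poly_step_time: "poly (step_time q) x = step_time (poly q x)"
  by (simp add: step_time_def layers_time_def free_time_def)

text \<open>One program and one polynomial serve all parameters because \<open>\<epsilon>\<close>
  enters the computation only through \<open>l\<close>, which is part of the input.\<close>

lemma explicit_online_matching:
  fixes G :: "nat \<Rightarrow> (bool list, bool list) bigraph"
  assumes G: "explicit_family G D"
  shows "\<exists>(P :: program) (p :: nat poly). \<forall>(n :: nat) (K :: nat) (\<epsilon> :: real).
    1 \<le> K \<and> 0 < \<epsilon> \<and> expander (G n) K ((1 - \<epsilon>) * real (D n)) \<and>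
    (K = 1 \<longrightarrow> (1 - 4 * \<epsilon>) * real (D n) \<le> 0) \<longrightarrow>
    (\<exists>f. online_matching (G n) ((1 - 4 * \<epsilon>) * real (D n)) (nat (2 * \<lceil>log 2 (real K)\<rceil>)) K f \<and>
         computes_assignment P p n K (D n) (nat \<lceil>(1 - 4 * \<epsilon>) * real (D n)\<rceil>) f)"
proof -
  obtain P p where Pp: "\<And>n x. x \<in> left_nodes (G n) \<Longrightarrow> \<exists>nb.
      neighbors (G n) x = mset (map nb [1..<Suc (D n)]) \<and>
      (\<forall>i\<in>{1..D n}.
         computes_within P (Node (enc_string x) (enc_nat i)) (enc_string (nb i)) (poly p n))"
    using G unfolding explicit_family_def by blast
  have graph: "bipartite_graph (G n)" "left_nodes (G n) = {x. length x = n}"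
      "left_degree (G n) (D n)" for n
    using G unfolding explicit_family_def by blast+
  \<comment> \<open>The bound \<open>M\<close> will be \<open>poly q (K + D n + n)\<close>: the
    square covers \<open>D n * length S\<close>, the linear part and 10 cover the sizes and the
    constant in \<open>length_computed_neighbor\<close>, and \<open>p\<close> covers the neighbor
    program.\<close>
  define q where "q = [:0, 1:] * [:0, 1:] + [:0, 1:] + 10 + p"
  have q: "poly q N = N * N + N + 10 + poly p N" for N
    by (simp add: q_def)
  define time where "time = (q + 1) * step_time q + 400 * (q + 1)"
  have time: "poly time N = (poly q N + 1) * step_time (poly q N) + 400 * (poly q N + 1)" for N
    by (simp add: time_def poly_step_time)
  show ?thesis
  proof (rule exI[of _ "matching_program P"], rule exI[of _ time], intro allI impI)
    fix n K :: nat and \<epsilon> :: real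
    assume *: "1 \<le> K \<and> 0 < \<epsilon> \<and> expander (G n) K ((1 - \<epsilon>) * real (D n)) \<and>
      (K = 1 \<longrightarrow> (1 - 4 * \<epsilon>) * real (D n) \<le> 0)"
    define l where "l = nat \<lceil>(1 - 4 * \<epsilon>) * real (D n)\<rceil>"
    have "(1 - 4 * \<epsilon>) * real (D n) \<le> real (D n)"
      using mult_right_mono[of "1 - 4 * \<epsilon>" 1 "real (D n)"] * by simp
    then have lD: "l \<le> D n" unfolding l_def by linarith
    \<comment> \<open>The length condition stands below the existential, so that choice yields a
      total \<open>nb\<close>.\<close>
    have "\<forall>x. \<exists>nb. length x = n \<longrightarrow> neighbors (G n) x = mset (map nb [1..<Suc (D n)]) \<and>
      (\<forall>i\<in>{1..D n}.
         computes_within P (Node (enc_string x) (enc_nat i)) (enc_string (nb i)) (poly p n))"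
      using Pp[of _ n] by (auto simp only: graph(2) mem_Collect_eq)
    then obtain nb where "\<forall>x. length x = n \<longrightarrow>
        neighbors (G n) x = mset (map (nb x) [1..<Suc (D n)]) \<and>
        (\<forall>i\<in>{1..D n}.
           computes_within P (Node (enc_string x) (enc_nat i)) (enc_string (nb x i)) (poly p n))"
      by (rule choice[THEN exE])
    then have nb: "\<And>x. length x = n \<Longrightarrow> neighbors (G n) x = mset (map (nb x) [1..<Suc (D n)])"
        "\<And>x i. length x = n \<Longrightarrow> 1 \<le> i \<Longrightarrow> i \<le> D n \<Longrightarrow>
           computes_within P (Node (enc_string x) (enc_nat i)) (enc_string (nb x i)) (poly p n)"
      by auto
    define f where "f = (\<lambda>S x. if l = 0 then {#}
      else mset (first_fit (\<lambda>y. map (nb y) [1..<Suc (D n)]) l x [] [] S))"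
    have "online_matching (G n) ((1 - 4 * \<epsilon>) * real (D n)) (nat (2 * \<lceil>log 2 (real K)\<rceil>)) K f"
      unfolding f_def
      by (rule online_matching_first_fit) (use * graph nb(1) l_def in auto)
    moreover have "computes_assignment (matching_program P) time n K (D n) l f"
      unfolding computes_assignment_def
    proof (intro allI impI)
      fix S :: "bool list list" and x :: "bool list"
      assume S: "set S \<subseteq> {y. length y = n} \<and> length S \<le> K \<and> length x = n"
      define M where "M = poly q (K + D n + n)"
      have M: "(K + D n + n) * (K + D n + n) + (K + D n + n) + 10 + poly p n \<le> M"
        unfolding M_def q by (simp add: poly_nat_mono)
      have "D n * length S \<le> (K + D n + n) * (K + D n + n)"
        using S by (intro mult_mono) auto
      then have DS: "D n * length S \<le> M" using M by linarith
      let ?zs = "if l = 0 then [] else first_fit (\<lambda>y. map (nb y) [1..<Suc (D n)]) l x [] [] S"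
      have "computes_within (matching_program P) (enc_matching_input K (D n) l S x)
          (enc_list enc_string ?zs) ((M + 1) * step_time M + 400 * (M + 1))"
      proof (rule computes_within_matching_program)
        fix y i assume y: "y \<in> set S" and i: "1 \<le> i" "i \<le> D n"
        then have c: "computes_within P (Node (enc_string y) (enc_nat i)) (enc_string (nb y i))
            (poly p n)"
          using S nb(2) by auto
        then show "computes_within P (Node (enc_string y) (enc_nat i)) (enc_string (nb y i)) M"
          by (rule computes_within_mono) (use M in linarith)
        show "length (nb y i) \<le> M"
          using length_computed_neighbor[OF c] S y i M by auto
      qed (use S M lD DS in auto)
      moreover have "mset ?zs = f S x" by (simp add: f_def)
      ultimately show "\<exists>zs. mset zs = f S x \<and>
          computes_within (matching_program P) (enc_matching_input K (D n) l S x)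
            (enc_list enc_string zs) (poly time (K + D n + n))"
        unfolding time M_def[symmetric] by blast
    qed
    ultimately show "\<exists>f. online_matching (G n) ((1 - 4 * \<epsilon>) * real (D n))
          (nat (2 * \<lceil>log 2 (real K)\<rceil>)) K f \<and>
        computes_assignment (matching_program P) time n K (D n)
          (nat \<lceil>(1 - 4 * \<epsilon>) * real (D n)\<rceil>) f"
      unfolding l_def by blast
  qed
qed

text \<open>The condition for \<open>Kmax = 1\<close> reflects
  \<open>online_matching_load_0\<close>: there the load bound is 0, so a graph with a left node can
  meet only a nonpositive demand.\<close>

theorem theorem2p8:
  shows
    "(\<forall>(G :: ('a, 'b) bigraph) (D :: nat) (Kmax :: nat) (\<epsilon> :: real).
        bipartite_graph G \<and> left_degree G D \<and> 1 \<le> Kmax \<and> 0 < \<epsilon> \<and>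
        expander G Kmax ((1 - \<epsilon>) * real D) \<and>
        (Kmax = 1 \<longrightarrow> (1 - 4 * \<epsilon>) * real D \<le> 0) \<longrightarrow>
        admits_online_matching G ((1 - 4 * \<epsilon>) * real D) (nat (2 * \<lceil>log 2 (real Kmax)\<rceil>)) Kmax)
     \<and>
     (\<forall>(G :: nat \<Rightarrow> (bool list, bool list) bigraph) (D :: nat \<Rightarrow> nat).
        explicit_family G D \<longrightarrow>
        (\<exists>(P :: program) (p :: nat poly). \<forall>(n :: nat) (Kmax :: nat) (\<epsilon> :: real).
           1 \<le> Kmax \<and> 0 < \<epsilon> \<and> expander (G n) Kmax ((1 - \<epsilon>) * real (D n)) \<and>
           (Kmax = 1 \<longrightarrow> (1 - 4 * \<epsilon>) * real (D n) \<le> 0) \<longrightarrow>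
           (\<exists>f. online_matching (G n) ((1 - 4 * \<epsilon>) * real (D n))
                  (nat (2 * \<lceil>log 2 (real Kmax)\<rceil>)) Kmax f \<and>
                computes_assignment P p n Kmax (D n) (nat \<lceil>(1 - 4 * \<epsilon>) * real (D n)\<rceil>) f)))"
proof (intro conjI allI impI)
  fix G :: "('a, 'b) bigraph" and D Kmax :: nat and \<epsilon> :: real
  assume *: "bipartite_graph G \<and> left_degree G D \<and> 1 \<le> Kmax \<and> 0 < \<epsilon> \<and>
    expander G Kmax ((1 - \<epsilon>) * real D) \<and> (Kmax = 1 \<longrightarrow> (1 - 4 * \<epsilon>) * real D \<le> 0)"
  \<comment> \<open>Where no running time is claimed, any listing of the neighbors will do.\<close>
  have "\<forall>x. \<exists>xs. mset xs = neighbors G x" by (simp add: ex_mset)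
  then obtain nb where "\<And>x. mset (nb x) = neighbors G x" by metis
  then show "admits_online_matching G ((1 - 4 * \<epsilon>) * real D)
      (nat (2 * \<lceil>log 2 (real Kmax)\<rceil>)) Kmax"
    unfolding admits_online_matching_def
    using * online_matching_first_fit[of G D Kmax \<epsilon> nb] by blast
qed (rule explicit_online_matching)

end
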